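(* For every topology $\tau$ on a set $X$ there exist a continuous quantale $Q$ and a $Q$-metric $d$ on $X$ such that $\tau$ coincides with the open ball topology $\tau_d$.
   Context: A quantale $(Q,\sqsubseteq,\otimes,\mathbb{1})$ is a complete lattice with a monoid structure $(Q,\otimes,\mathbb{1})$ such that $\otimes$ distributes over arbitrary joins on both sides. In a complete lattice, $x\ll y$ (way-below) means: for every directed $D$, $y\sqsubseteq\bigsqcup D$ implies $x\sqsubseteq d$ for some $d\in D$. A quantale is continuous if $y=\bigsqcup\{x:x\ll y\}$ for all $y$. A $Q$-metric on $X$ is a map $d:X\times X\to Q$ with $d(x,y)\otimes d(y,z)\sqsubseteq d(x,z)$ and $\mathbb{1}\sqsubseteq d(x,x)$. For $\delta\ll\mathbb{1}$, the open ball is $B(x,\delta)=\{y\in X:\delta\ll d(x,y)\}$, and $\tau_d$ is the topology generated by all open balls. *)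

theory Defs
  imports "HOL-Analysis.Analysis" "HOL-Algebra.Complete_Lattice" "HOL-Algebra.Group"
begin

definition directed_in :: "('q, 'm) gorder_scheme \<Rightarrow> 'q set \<Rightarrow> bool" where
  "directed_in L D \<longleftrightarrow>
     D \<subseteq> carrier L \<and> D \<noteq> {} \<and> (\<forall>x\<in>D. \<forall>y\<in>D. \<exists>z\<in>D. x \<sqsubseteq>\<^bsub>L\<^esub> z \<and> y \<sqsubseteq>\<^bsub>L\<^esub> z)"

definition way_below :: "('q, 'm) gorder_scheme \<Rightarrow> 'q \<Rightarrow> 'q \<Rightarrow> bool" where
  "way_below L x y \<longleftrightarrow>
     x \<in> carrier L \<and> y \<in> carrier L \<and>
     (\<forall>D. directed_in L D \<longrightarrow> y \<sqsubseteq>\<^bsub>L\<^esub> \<Squnion>\<^bsub>L\<^esub>D \<longrightarrow> (\<exists>d\<in>D. x \<sqsubseteq>\<^bsub>L\<^esub> d))"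

record 'q quantale = "'q monoid" +
  qle :: "'q \<Rightarrow> 'q \<Rightarrow> bool"

definition order_of :: "('q, 'm) quantale_scheme \<Rightarrow> 'q gorder" where
  "order_of Q = \<lparr>carrier = carrier Q, eq = (=), le = qle Q\<rparr>"

locale quantale = monoid Q + order: complete_lattice "order_of Q"
  for Q (structure) +
  assumes distrib_left:
      "\<lbrakk>a \<in> carrier Q; A \<subseteq> carrier Q\<rbrakk> \<Longrightarrow>
        a \<otimes> \<Squnion>\<^bsub>order_of Q\<^esub>A = \<Squnion>\<^bsub>order_of Q\<^esub>((\<lambda>x. a \<otimes> x) ` A)"
    and distrib_right:
      "\<lbrakk>a \<in> carrier Q; A \<subseteq> carrier Q\<rbrakk> \<Longrightarrow>
        \<Squnion>\<^bsub>order_of Q\<^esub>A \<otimes> a = \<Squnion>\<^bsub>order_of Q\<^esub>((\<lambda>x. x \<otimes> a) ` A)"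

locale continuous_quantale = quantale +
  assumes continuous:
    "y \<in> carrier Q \<Longrightarrow> y = \<Squnion>\<^bsub>order_of Q\<^esub>{x \<in> carrier Q. way_below (order_of Q) x y}"

definition quantale_metric_on ::
    "('q, 'm) quantale_scheme \<Rightarrow> 'a set \<Rightarrow> ('a \<Rightarrow> 'a \<Rightarrow> 'q) \<Rightarrow> bool" where
  "quantale_metric_on Q X d \<longleftrightarrow>
     (\<forall>x\<in>X. \<forall>y\<in>X. d x y \<in> carrier Q) \<and>
     (\<forall>x\<in>X. \<forall>y\<in>X. \<forall>z\<in>X. d x y \<otimes>\<^bsub>Q\<^esub> d y z \<sqsubseteq>\<^bsub>order_of Q\<^esub> d x z) \<and>
     (\<forall>x\<in>X. \<one>\<^bsub>Q\<^esub> \<sqsubseteq>\<^bsub>order_of Q\<^esub> d x x)"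

definition open_ball ::
    "('q, 'm) quantale_scheme \<Rightarrow> 'a set \<Rightarrow> ('a \<Rightarrow> 'a \<Rightarrow> 'q) \<Rightarrow> 'a \<Rightarrow> 'q \<Rightarrow> 'a set" where
  "open_ball Q X d x \<delta> = {y \<in> X. way_below (order_of Q) \<delta> (d x y)}"

definition open_ball_topology ::
    "('q, 'm) quantale_scheme \<Rightarrow> 'a set \<Rightarrow> ('a \<Rightarrow> 'a \<Rightarrow> 'q) \<Rightarrow> 'a topology" where
  "open_ball_topology Q X d =
     topology_generated_by
       {open_ball Q X d x \<delta> |x \<delta>. x \<in> X \<and> way_below (order_of Q) \<delta> \<one>\<^bsub>Q\<^esub>}"

(* topology_generated_by S always lives on the union of S. Here this union is X,
   because the balls of radius bottom are all of X. *)

lemma (in complete_lattice) bottom_way_below: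
  assumes "y \<in> carrier L"
  shows "way_below L \<bottom> y"
  using assms by (auto simp: way_below_def directed_in_def bottom_closed) (metis bottom_lower subsetD)

lemma (in quantale) topspace_open_ball_topology:
  assumes "quantale_metric_on Q X d"
  shows "topspace (open_ball_topology Q X d) = X"
proof -
  have c: "carrier (order_of Q) = carrier Q"
    by (simp add: order_of_def)
  have "open_ball Q X d x \<bottom>\<^bsub>order_of Q\<^esub> = X" if "x \<in> X" for x
    using that assms order.bottom_way_below
    by (auto simp: open_ball_def quantale_metric_on_def c)
  moreover have "way_below (order_of Q) \<bottom>\<^bsub>order_of Q\<^esub> \<one>"
    using order.bottom_way_below c by simp
  moreover have "open_ball Q X d x \<delta> \<subseteq> X" for x \<delta>
    by (auto simp: open_ball_def)
  ultimately show ?thesis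
    unfolding open_ball_topology_def topology_generated_by_topspace by blast
qed

end

theory Submission
  imports Defs
begin

text \<open>
  The quantale is the powerset of the set of open sets, ordered by inclusion and with intersection as
  multiplication, and \<open>d(x, y)\<close> consists of the open sets \<open>U\<close> such that \<open>x \<in> U\<close> implies \<open>y \<in> U\<close>.
  In a powerset \<open>S \<lless> T\<close> means that \<open>S\<close> is a finite subset of \<open>T\<close>. Therefore a ball around \<open>x\<close> is the
  intersection of the finitely many members of its radius that contain \<open>x\<close>, and the ball of radius
  \<open>{U}\<close> is \<open>U\<close> itself.
\<close>

definition powerset_quantale :: "'b set \<Rightarrow> 'b set quantale" where
  "powerset_quantale A = \<lparr>carrier = Pow A, mult = (\<inter>), one = A, qle = (\<subseteq>)\<rparr>"

lemma powerset_quantale_simps [simp]: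
  "carrier (powerset_quantale A) = Pow A"
  "mult (powerset_quantale A) = (\<inter>)"
  "one (powerset_quantale A) = A"
  by (simp_all add: powerset_quantale_def)

lemma order_of_powerset_quantale:
  "order_of (powerset_quantale A) = \<lparr>carrier = Pow A, eq = (=), le = (\<subseteq>)\<rparr>"
  by (simp add: order_of_def powerset_quantale_def)

lemma order_of_powerset_quantale_simps [simp]:
  "carrier (order_of (powerset_quantale A)) = Pow A"
  "le (order_of (powerset_quantale A)) = (\<subseteq>)"
  by (simp_all add: order_of_powerset_quantale)

lemma complete_lattice_powerset_quantale:
  "complete_lattice (order_of (powerset_quantale A))"
  unfolding order_of_powerset_quantale by (rule powerset_is_complete_lattice)

text \<open>\<open>sup\<close> picks some least upper bound by choice. The union is one, and
  antisymmetry leaves no other candidate.\<close>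

lemma sup_powerset_quantale:
  assumes "F \<subseteq> Pow A"
  shows "\<Squnion>\<^bsub>order_of (powerset_quantale A)\<^esub>F = \<Union>F"
proof -
  interpret L: complete_lattice "order_of (powerset_quantale A)"
    by (rule complete_lattice_powerset_quantale)
  have lub: "least (order_of (powerset_quantale A)) (\<Union>F) (Upper (order_of (powerset_quantale A)) F)"
  proof (rule least_UpperI)
    fix Y
    assume "Y \<in> Upper (order_of (powerset_quantale A)) F"
    then have "\<forall>Z\<in>F. Z \<subseteq> Y"
      using assms unfolding Upper_def order_of_powerset_quantale_simps by blast
    then show "le (order_of (powerset_quantale A)) (\<Union>F) Y"
      by auto
  qed (use assms in auto)
  show ?thesis
    unfolding sup_def by (rule some_equality, rule lub) (rule L.least_unique[OF _ lub])
qed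

text \<open>Both distributive laws reduce to the distributivity of intersection over arbitrary
  unions; \<open>img\<close> lets the suprema of the image families be computed as unions
  too.\<close>

lemma quantale_powerset_quantale: "quantale (powerset_quantale A)"
proof -
  interpret L: complete_lattice "order_of (powerset_quantale A)"
    by (rule complete_lattice_powerset_quantale)
  have img: "(\<lambda>x. a \<inter> x) ` F \<subseteq> Pow A" "(\<lambda>x. x \<inter> a) ` F \<subseteq> Pow A" if "F \<subseteq> Pow A" for a F
    using that by auto
  show ?thesis
    by unfold_locales (auto simp: sup_powerset_quantale img)
qed

lemma way_below_powerset_quantale_iff:
  "way_below (order_of (powerset_quantale A)) S T \<longleftrightarrow> finite S \<and> S \<subseteq> T \<and> T \<subseteq> A"
proof
  assume wb: "way_below (order_of (powerset_quantale A)) S T"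
  \<comment> \<open>\<open>T\<close> is the directed union of its finite subsets, so testing
    \<open>S\<close> against this family puts \<open>S\<close> inside one of them.\<close>
  define D where "D = {F. finite F \<and> F \<subseteq> T}"
  have TA: "T \<subseteq> A"
    using wb by (simp add: way_below_def)
  then have D: "D \<subseteq> Pow A"
    by (auto simp: D_def)
  have "F \<union> G \<in> D" if "F \<in> D" "G \<in> D" for F G
    using that by (auto simp: D_def)
  moreover have "{} \<in> D"
    by (simp add: D_def)
  ultimately have "directed_in (order_of (powerset_quantale A)) D"
    using D unfolding directed_in_def order_of_powerset_quantale_simps
    by (metis Un_upper1 Un_upper2 empty_iff)
  moreover have "T \<subseteq> \<Squnion>\<^bsub>order_of (powerset_quantale A)\<^esub>D"
  proof
    fix x
    assume "x \<in> T"
    then have "{x} \<in> D"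
      by (simp add: D_def)
    then show "x \<in> \<Squnion>\<^bsub>order_of (powerset_quantale A)\<^esub>D"
      unfolding sup_powerset_quantale[OF D] by blast
  qed
  ultimately have "\<exists>F\<in>D. S \<subseteq> F"
    using wb by (simp add: way_below_def)
  then obtain F where "F \<in> D" "S \<subseteq> F" ..
  then show "finite S \<and> S \<subseteq> T \<and> T \<subseteq> A"
    using TA by (auto simp: D_def intro: finite_subset)
next
  assume S: "finite S \<and> S \<subseteq> T \<and> T \<subseteq> A"
  have "\<exists>d\<in>D. S \<subseteq> d"
    if dir: "directed_in (order_of (powerset_quantale A)) D"
      and le: "T \<subseteq> \<Squnion>\<^bsub>order_of (powerset_quantale A)\<^esub>D" for D
  proof -
    have "S \<subseteq> \<Union>D"
      using S le dir by (auto simp: directed_in_def sup_powerset_quantale)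
    with S have "finite S" "S \<subseteq> \<Union>D"
      by auto
    then show ?thesis
    \<comment> \<open>Each point of \<open>S\<close> lies in some member of \<open>D\<close>, and
      directedness merges these finitely many members into one. The empty case rests on
      \<open>D\<close> being nonempty.\<close>
    proof (induction S rule: finite_induct)
      case empty
      then show ?case
        using dir by (auto simp: directed_in_def)
    next
      case (insert x S)
      then obtain d e where "d \<in> D" "S \<subseteq> d" "e \<in> D" "x \<in> e"
        by auto
      moreover from this obtain f where "f \<in> D" "d \<subseteq> f" "e \<subseteq> f"
        using dir unfolding directed_in_def order_of_powerset_quantale_simps by blast
      ultimately show ?case
        by blast
    qed
  qed
  then show "way_below (order_of (powerset_quantale A)) S T"
    using S by (auto simp: way_below_def)
qed

text \<open>Every set is the union of its finite subsets; the singletons already cover it.\<close>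

lemma continuous_quantale_powerset_quantale: "continuous_quantale (powerset_quantale A)"
proof -
  interpret quantale "powerset_quantale A"
    by (rule quantale_powerset_quantale)
  show ?thesis
  proof
    fix T
    assume T: "T \<in> carrier (powerset_quantale A)"
    define W where
      "W = {S \<in> carrier (powerset_quantale A). way_below (order_of (powerset_quantale A)) S T}"
    have "W = {S. finite S \<and> S \<subseteq> T}"
      using T by (auto simp: W_def way_below_powerset_quantale_iff)
    moreover have "x \<in> \<Union>{S. finite S \<and> S \<subseteq> T}" if "x \<in> T" for x
      using that by (intro UnionI[of "{x}"]) auto
    then have "\<Union>{S. finite S \<and> S \<subseteq> T} = T"
      by blast
    moreover have "W \<subseteq> Pow A"
      by (auto simp: W_def)
    ultimately show "T = \<Squnion>\<^bsub>order_of (powerset_quantale A)\<^esub>W"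
      by (simp add: sup_powerset_quantale)
  qed
qed

text \<open>Coordinatewise, this is a family of two-valued metrics indexed by the open sets. The
  implication is deliberately one-sided: with an equivalence, the complement of \<open>U\<close>
  could become a ball as well.\<close>

definition open_set_dist :: "'a topology \<Rightarrow> 'a \<Rightarrow> 'a \<Rightarrow> 'a set set" where
  "open_set_dist \<tau> x y = {U. openin \<tau> U \<and> (x \<in> U \<longrightarrow> y \<in> U)}"

text \<open>The triangle inequality is transitivity of implication for each \<open>U\<close>, and
  the unit law is its reflexivity.\<close>

lemma quantale_metric_on_open_set_dist:
  "quantale_metric_on (powerset_quantale {U. openin \<tau> U}) X (open_set_dist \<tau>)"
  by (auto simp: quantale_metric_on_def open_set_dist_def)

text \<open>Since \<open>\<delta>\<close> is finite, the way-below condition shrinks to inclusion in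
  the distance, which is checked one \<open>U\<close> at a time.\<close>

lemma open_ball_open_set_dist:
  assumes "finite \<delta>" "\<And>U. U \<in> \<delta> \<Longrightarrow> openin \<tau> U"
  shows "open_ball (powerset_quantale {U. openin \<tau> U}) X (open_set_dist \<tau>) x \<delta> =
    {y \<in> X. \<forall>U\<in>\<delta>. x \<in> U \<longrightarrow> y \<in> U}"
  using assms by (auto simp: open_ball_def open_set_dist_def way_below_powerset_quantale_iff)

lemma open_ball_topology_open_set_dist:
  "open_ball_topology (powerset_quantale {U. openin \<tau> U}) (topspace \<tau>) (open_set_dist \<tau>) = \<tau>"
  (is "open_ball_topology ?Q ?X ?d = \<tau>")
proof -
  define \<B> where "\<B> = {open_ball ?Q ?X ?d x \<delta> |x \<delta>. x \<in> ?X \<and> way_below (order_of ?Q) \<delta> \<one>\<^bsub>?Q\<^esub>}"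
  have "openin \<tau> V" if "openin (topology_generated_by \<B>) V" for V
  proof -
    have "openin \<tau> B" if "B \<in> \<B>" for B
    proof -
      obtain x \<delta> where B: "B = open_ball ?Q ?X ?d x \<delta>" and wb: "way_below (order_of ?Q) \<delta> \<one>\<^bsub>?Q\<^esub>"
        using \<open>B \<in> \<B>\<close> unfolding \<B>_def mem_Collect_eq by (elim exE conjE)
      from wb have \<delta>: "finite \<delta>" "\<delta> \<subseteq> {U. openin \<tau> U}"
        by (simp_all add: way_below_powerset_quantale_iff)
      then have "B = {y \<in> ?X. \<forall>U\<in>\<delta>. x \<in> U \<longrightarrow> y \<in> U}"
        unfolding B by (intro open_ball_open_set_dist) auto
      then have "B = ?X \<inter> \<Inter>{U \<in> \<delta>. x \<in> U}"
        by blast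
      \<comment> \<open>Inserting \<open>?X\<close> keeps the family nonempty when no member of
        \<open>\<delta>\<close> contains \<open>x\<close>.\<close>
      moreover have "openin \<tau> (\<Inter>(insert ?X {U \<in> \<delta>. x \<in> U}))"
        using \<delta> by (intro openin_Inter) auto
      ultimately show ?thesis
        by simp
    qed
    then show ?thesis
      by (rule generate_topology_on_coarsest[OF istopology_openin _ openin_topology_generated_by[OF that]])
  qed
  \<comment> \<open>The empty set is treated apart because it offers no centre. For other
    \<open>V\<close>, a centre inside \<open>V\<close> makes the premise of the implication true, so
    the ball of radius \<open>{V}\<close> is exactly \<open>V\<close>.\<close>
  moreover have "openin (topology_generated_by \<B>) V" if V: "openin \<tau> V" for V
  proof (cases "V = {}")
    case False
    then obtain x where x: "x \<in> V"
      by blast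
    have "open_ball ?Q ?X ?d x {V} = V"
      using V x openin_subset[OF V] by (subst open_ball_open_set_dist) auto
    moreover have "way_below (order_of ?Q) {V} \<one>\<^bsub>?Q\<^esub>"
      using V by (simp add: way_below_powerset_quantale_iff)
    moreover have "x \<in> ?X"
      using x openin_subset[OF V] by blast
    ultimately have "V \<in> \<B>"
      unfolding \<B>_def by blast
    then show ?thesis
      by (rule topology_generated_by_Basis)
  qed simp
  ultimately have "topology_generated_by \<B> = \<tau>"
    by (auto simp: topology_eq)
  then show ?thesis
    by (simp only: open_ball_topology_def \<B>_def)
qed

theorem theorem44:
  fixes \<tau> :: "'a topology"
  shows "\<exists>(Q :: 'a set set quantale) (d :: 'a \<Rightarrow> 'a \<Rightarrow> 'a set set).
           continuous_quantale Q \<and>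
           quantale_metric_on Q (topspace \<tau>) d \<and>
           open_ball_topology Q (topspace \<tau>) d = \<tau>"
  using continuous_quantale_powerset_quantale quantale_metric_on_open_set_dist
    open_ball_topology_open_set_dist
  by blast

end
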